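(* Let $X$ be a complex Banach space, $\mathcal D\subset\mathcal D_e\subset X$ two not necessarily dense linear subspaces, and $T:\mathcal D\to X$, $T_e:\mathcal D_e\to X$ two linear operators, not necessarily bounded or closed, with $T_e$ extending $T$. Let $\Lambda$ be a non-empty set and, for each $\lambda\in\Lambda$, let $L_\lambda$ be a complex normed space. Suppose that there exist a linear map $\mathcal F:X\to\prod_{\lambda\in\Lambda}L_\lambda$, injective on $\mathcal D_e$, and a map $\varepsilon:\Lambda\to\mathbb C$, such that $\mathcal F(T_ex)(\lambda)=\varepsilon(\lambda)\,\mathcal Fx(\lambda)$ for all $\lambda\in\Lambda$ and all $x\in\mathcal D_e$. Suppose furthermore that, for each $\lambda\in\Lambda$, the map $x\mapsto\mathcal Fx(\lambda)$ from $\mathcal D_e$ to $L_\lambda$ is continuous on $\mathcal D_e$ in the topology induced by $X$. Then the operator $T_e$ has the single-valued extension property.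
   Context: For $s\in\prod_{\lambda\in\Lambda}L_\lambda$, $s(\lambda)$ denotes the $\lambda$-th coordinate of $s$. An operator $S$ with domain $\mathcal D(S)\subset X$ has the single-valued extension property if, for every non-empty open subset $U\subset\mathbb C$, the only analytic $\phi:U\to\mathcal D(S)$, $z\mapsto\phi_z$, satisfying $(S-z)\phi_z=0$ for all $z\in U$ is the zero function. Here analyticity of $\phi$ is with respect to the norm of $X$ (that is, $\phi$ is an analytic $X$-valued function with values in $\mathcal D(S)$). *)

theory Defs
  imports "HOL-Analysis.Analysis" "HOL-Algebra.Module"
begin

section \<open>Complex Banach spaces\<close>

class scaleC =
  fixes scaleC :: "complex \<Rightarrow> 'a \<Rightarrow> 'a"  (infixr \<open>*\<^sub>C\<close> 75)

class complex_normed_vector = real_normed_vector + scaleC +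
  assumes scaleC_add_right: "a *\<^sub>C (x + y) = a *\<^sub>C x + a *\<^sub>C y"
    and scaleC_add_left: "(a + b) *\<^sub>C x = a *\<^sub>C x + b *\<^sub>C x"
    and scaleC_scaleC: "a *\<^sub>C (b *\<^sub>C x) = (a * b) *\<^sub>C x"
    and scaleC_one: "1 *\<^sub>C x = x"
    and scaleR_eq_scaleC: "r *\<^sub>R x = complex_of_real r *\<^sub>C x"
    and norm_scaleC: "norm (a *\<^sub>C x) = cmod a * norm x"

class complex_banach = complex_normed_vector + complete_space

subclass (in complex_banach) banach ..

global_interpretation complex_vector:
  vector_space "scaleC :: complex \<Rightarrow> 'a \<Rightarrow> 'a::complex_normed_vector"
  defines csubspace = complex_vector.subspace
  by unfold_locales (auto simp: scaleC_add_right scaleC_add_left scaleC_scaleC scaleC_one)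


section \<open>Complex normed spaces given by a carrier set\<close>

text \<open>The spaces \<open>L\<^sub>\<lambda>\<close> vary with the index, so they cannot be types. They are carrier-based
  vector spaces over the complex numbers (modules in the sense of HOL-Algebra, whose
  ring multiplication and unit fields play no role) together with a norm. All carriers are
  subsets of one type, which is no restriction: a family of sets always embeds in its
  disjoint union.\<close>

definition complex_field :: "complex ring" where
  "complex_field = \<lparr>carrier = UNIV, mult = (*), one = 1, zero = 0, add = (+)\<rparr>"

record 'l normed_module = "(complex, 'l) module" +
  vnorm :: "'l \<Rightarrow> real"

locale complex_normed_space = Module.module complex_field L
  for L :: "('l, 'm) normed_module_scheme" (structure) +
  assumes vnorm_eq_zero: "u \<in> carrier L \<Longrightarrow> vnorm L u = 0 \<longleftrightarrow> u = \<zero>"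
    and vnorm_triangle:
      "u \<in> carrier L \<Longrightarrow> v \<in> carrier L \<Longrightarrow> vnorm L (u \<oplus> v) \<le> vnorm L u + vnorm L v"
    and vnorm_smult: "u \<in> carrier L \<Longrightarrow> vnorm L (a \<odot> u) = cmod a * vnorm L u"

text \<open>The value outside the carrier is needed because \<open>Metric_space\<close> requires the
  distance to be nonnegative and symmetric on the whole type.\<close>

definition norm_dist :: "('l, 'm) normed_module_scheme \<Rightarrow> 'l \<Rightarrow> 'l \<Rightarrow> real" where
  "norm_dist L u v =
     (if u \<in> carrier L \<and> v \<in> carrier L then vnorm L (u \<ominus>\<^bsub>L\<^esub> v) else 0)"

definition norm_topology :: "('l, 'm) normed_module_scheme \<Rightarrow> 'l topology" where
  "norm_topology L = Metric_space.mtopology (carrier L) (norm_dist L)"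

context complex_normed_space
begin

lemma vnorm_minus:
  assumes "u \<in> carrier L" shows "vnorm L (\<ominus> u) = vnorm L u"
proof -
  have c: "carrier complex_field = UNIV" "\<one>\<^bsub>complex_field\<^esub> = 1"
    by (auto simp: complex_field_def)
  have "(-1::complex) \<oplus>\<^bsub>complex_field\<^esub> 1 = \<zero>\<^bsub>complex_field\<^esub>"
    by (simp add: complex_field_def)
  then have "(-1) \<odot> u \<oplus> u = \<zero>"
    using smult_l_distr[of "-1" "1" u] smult_one[OF assms] smult_l_null[OF assms] assms
    by (simp add: c)
  then have "\<ominus> u = (-1) \<odot> u"
    using assms by (intro minus_equality) (auto simp: c)
  then show ?thesis
    using vnorm_smult[OF assms, of "-1"] by simp
qed

lemma vnorm_nonneg:
  assumes "u \<in> carrier L" shows "0 \<le> vnorm L u"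
  using vnorm_triangle[of u "\<ominus> u"] vnorm_minus[OF assms] vnorm_eq_zero[of \<zero>] assms
  by (simp add: r_neg)

sublocale Metric_space "carrier L" "norm_dist L"
proof
  fix u v w
  show "0 \<le> norm_dist L u v"
    by (simp add: norm_dist_def vnorm_nonneg)
  show "norm_dist L u v = norm_dist L v u"
  proof (cases "u \<in> carrier L \<and> v \<in> carrier L")
    case True
    then have "\<ominus> (u \<ominus> v) = v \<ominus> u"
      by (simp add: a_minus_def minus_add a_comm)
    with True show ?thesis
      by (metis norm_dist_def vnorm_minus minus_closed)
  qed (auto simp: norm_dist_def)
  assume u: "u \<in> carrier L" and v: "v \<in> carrier L"
  show "norm_dist L u v = 0 \<longleftrightarrow> u = v"
  proof -
    have "u \<ominus> v = \<zero> \<longleftrightarrow> u = v"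
      using u v by (metis a_minus_def a_inv_closed minus_equality minus_minus r_neg)
    with u v show ?thesis
      by (simp add: norm_dist_def vnorm_eq_zero)
  qed
  assume w: "w \<in> carrier L"
  have "u \<ominus> w = (u \<ominus> v) \<oplus> (v \<ominus> w)"
    using u v w by (simp add: a_minus_def a_assoc r_neg2 r_neg1 l_neg)
  then show "norm_dist L u w \<le> norm_dist L u v + norm_dist L v w"
    using u v w vnorm_triangle[of "u \<ominus> v" "v \<ominus> w"] by (simp add: norm_dist_def)
qed

end


section \<open>Linear maps\<close>

definition clinear_on ::
  "'x::complex_normed_vector set \<Rightarrow> ('x \<Rightarrow> 'x) \<Rightarrow> bool" where
  "clinear_on D S \<longleftrightarrow>
     (\<forall>x\<in>D. \<forall>y\<in>D. S (x + y) = S x + S y) \<and>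
     (\<forall>c. \<forall>x\<in>D. S (c *\<^sub>C x) = c *\<^sub>C S x)"

text \<open>Extensional functions make equality in the product coincide with equality of
  all coordinates.\<close>

definition clinear_into_product ::
  "'i set \<Rightarrow> ('i \<Rightarrow> ('l, 'm) normed_module_scheme) \<Rightarrow>
   ('x::complex_normed_vector \<Rightarrow> 'i \<Rightarrow> 'l) \<Rightarrow> bool" where
  "clinear_into_product \<Lambda> L F \<longleftrightarrow>
     (\<forall>x. F x \<in> (\<Pi>\<^sub>E i\<in>\<Lambda>. carrier (L i))) \<and>
     (\<forall>x y. \<forall>i\<in>\<Lambda>. F (x + y) i = F x i \<oplus>\<^bsub>L i\<^esub> F y i) \<and>
     (\<forall>c x. \<forall>i\<in>\<Lambda>. F (c *\<^sub>C x) i = c \<odot>\<^bsub>L i\<^esub> F x i)"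


section \<open>The single-valued extension property\<close>

text \<open>As for the library's \<open>holomorphic_on\<close> on open sets, analyticity is complex
  differentiability at every point, here with respect to the norm.\<close>

definition vector_analytic_on ::
  "(complex \<Rightarrow> 'x::complex_normed_vector) \<Rightarrow> complex set \<Rightarrow> bool" where
  "vector_analytic_on \<phi> U \<longleftrightarrow>
     open U \<and> (\<forall>z\<in>U. \<exists>d. (\<phi> has_derivative (\<lambda>h. h *\<^sub>C d)) (at z))"

text \<open>A partially defined operator is a pair of a domain \<open>D\<close> and a total
  function \<open>S\<close> whose values outside \<open>D\<close> are irrelevant.\<close>

definition svep ::
  "'x::complex_normed_vector set \<Rightarrow> ('x \<Rightarrow> 'x) \<Rightarrow> bool" where
  "svep D S \<longleftrightarrow>
     (\<forall>U \<phi>. open U \<and> U \<noteq> {} \<and> vector_analytic_on \<phi> U \<and> (\<forall>z\<in>U. \<phi> z \<in> D) \<and>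
            (\<forall>z\<in>U. S (\<phi> z) - z *\<^sub>C \<phi> z = 0)
       \<longrightarrow> (\<forall>z\<in>U. \<phi> z = 0))"

end

theory Submission
  imports Defs
begin

text \<open>Apply \<open>F\<close> to a local analytic solution of \<open>(T\<^sub>e - z) \<phi>\<^sub>z = 0\<close> and read off the coordinate at
  \<open>\<lambda>\<close>: since \<open>F\<close> turns \<open>T\<^sub>e\<close> into multiplication by \<open>\<epsilon>\<close>, one gets
  \<open>\<epsilon>(\<lambda>) F \<phi>\<^sub>z(\<lambda>) = z F \<phi>\<^sub>z(\<lambda>)\<close>. Hence \<open>F \<phi>\<^sub>z(\<lambda>)\<close> vanishes for every \<open>z\<close> except possibly the single
  value \<open>z = \<epsilon>(\<lambda>)\<close> (\<open>smult_eq_smult_imp_zero\<close>). The exceptional value is removed by continuity: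
  \<open>z \<mapsto> F \<phi>\<^sub>z(\<lambda>)\<close> is continuous, and a point of an open subset of the plane is never isolated
  (\<open>continuous_map_constant_off_point\<close>). So all coordinates of \<open>F \<phi>\<^sub>z\<close> vanish, and injectivity of
  \<open>F\<close> on \<open>D\<^sub>e\<close> gives \<open>\<phi>\<^sub>z = 0\<close>. The exceptional value depends on \<open>\<lambda>\<close>, which is why the argument
  has to be completed in each coordinate before injectivity is used.\<close>

lemma (in complex_normed_space) smult_eq_smult_imp_zero:
  assumes u: "u \<in> carrier L" and eq: "a \<odot> u = b \<odot> u" and "a \<noteq> b"
  shows "u = \<zero>"
proof -
  have closed: "c \<odot> u \<in> carrier L" for c
    using u by (intro smult_closed) (auto simp: complex_field_def)
  have "a \<odot> u = (a - b) \<odot> u \<oplus> b \<odot> u"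
    using smult_l_distr[of "a - b" b u] u by (simp add: complex_field_def)
  then have "(a - b) \<odot> u = \<zero>"
    using eq closed by (metis add.l_cancel_one' a_comm zero_closed)
  then have "cmod (a - b) * vnorm L u = 0"
    using vnorm_smult[OF u] vnorm_eq_zero[OF closed] by metis
  then show ?thesis
    using \<open>a \<noteq> b\<close> vnorm_eq_zero[OF u] by simp
qed

text \<open>The set where \<open>f\<close> differs from \<open>c\<close> is open, as points of a \<open>T\<^sub>1\<close> space are closed, and it is
  contained in \<open>{w}\<close>. As singletons are not open in a perfect space, it is empty.\<close>

lemma continuous_map_constant_off_point:
  fixes U :: "'a::perfect_space set"
  assumes f: "continuous_map (top_of_set U) Y f" and Y: "t1_space Y"
    and U: "open U" and off: "\<And>z. z \<in> U \<Longrightarrow> z \<noteq> w \<Longrightarrow> f z = c" and z: "z \<in> U"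
    and c: "c \<in> topspace Y"
  shows "f z = c"
proof (rule ccontr)
  assume ne: "f z \<noteq> c"
  have "closedin Y {c}"
    using Y c by (simp add: t1_space_closedin_singleton)
  then have "openin Y (topspace Y - {c})"
    by blast
  then have "openin (top_of_set U) {x \<in> U. f x \<in> topspace Y - {c}}"
    using openin_continuous_map_preimage[OF f, of "topspace Y - {c}"]
    by (simp only: topspace_euclidean_subtopology)
  then have "open {x \<in> U. f x \<in> topspace Y - {c}}"
    using U openin_open_trans by blast
  moreover have "{x \<in> U. f x \<in> topspace Y - {c}} = {z}"
    using ne z off continuous_map_image_subset_topspace[OF f] by auto
  ultimately show False
    using not_open_singleton by metis
qed

lemma vector_analytic_on_imp_continuous_on:
  assumes "vector_analytic_on \<phi> U"
  shows "continuous_on U \<phi>"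
  using assms unfolding vector_analytic_on_def
  by (meson continuous_at_imp_continuous_on has_derivative_continuous)

theorem theorem2p1:
  fixes D D\<^sub>e :: "'x::complex_banach set"
    and T T\<^sub>e :: "'x \<Rightarrow> 'x"
    and \<Lambda> :: "'i set"
    and L :: "'i \<Rightarrow> 'l normed_module"
    and F :: "'x \<Rightarrow> 'i \<Rightarrow> 'l"
    and \<epsilon> :: "'i \<Rightarrow> complex"
  assumes "csubspace D" and "csubspace D\<^sub>e" and "D \<subseteq> D\<^sub>e"
    and "clinear_on D T" and "clinear_on D\<^sub>e T\<^sub>e"
    and "\<forall>x\<in>D. T\<^sub>e x = T x"
    and "\<Lambda> \<noteq> {}"
    and "\<forall>i\<in>\<Lambda>. complex_normed_space (L i)"
    and "clinear_into_product \<Lambda> L F"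
    and "inj_on F D\<^sub>e"
    and "\<forall>i\<in>\<Lambda>. \<forall>x\<in>D\<^sub>e. F (T\<^sub>e x) i = \<epsilon> i \<odot>\<^bsub>L i\<^esub> F x i"
    and "\<forall>i\<in>\<Lambda>. continuous_map (top_of_set D\<^sub>e) (norm_topology (L i)) (\<lambda>x. F x i)"
  shows "svep D\<^sub>e T\<^sub>e"
  unfolding svep_def
proof (intro allI impI ballI; elim conjE)
  fix U \<phi> z
  assume U: "open U" and an: "vector_analytic_on \<phi> U"
    and dom: "\<forall>z\<in>U. \<phi> z \<in> D\<^sub>e" and eig: "\<forall>z\<in>U. T\<^sub>e (\<phi> z) - z *\<^sub>C \<phi> z = 0"
    and z: "z \<in> U"
  have cont: "continuous_map (top_of_set U) (top_of_set D\<^sub>e) \<phi>"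
    using vector_analytic_on_imp_continuous_on[OF an] dom by (auto simp: continuous_map_in_subtopology)
  have F_ext: "F x \<in> (\<Pi>\<^sub>E i\<in>\<Lambda>. carrier (L i))" for x
    using assms(9) by (simp add: clinear_into_product_def)
  have F_scale: "F (c *\<^sub>C x) i = c \<odot>\<^bsub>L i\<^esub> F x i" if "i \<in> \<Lambda>" for c x i
    using assms(9) that by (simp add: clinear_into_product_def)
  have F_zero: "F 0 i = \<zero>\<^bsub>L i\<^esub>" if i: "i \<in> \<Lambda>" for i
  proof -
    interpret complex_normed_space "L i" using assms(8) i by blast
    have "F 0 i \<in> carrier (L i)" using F_ext i by blast
    then show ?thesis
      using F_scale[OF i, of 0 0] smult_l_null by (simp add: complex_field_def)
  qed
  have coord: "F (\<phi> z) i = \<zero>\<^bsub>L i\<^esub>" if i: "i \<in> \<Lambda>" for i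
  proof -
    interpret complex_normed_space "L i" using assms(8) i by blast
    have off: "F (\<phi> w) i = \<zero>\<^bsub>L i\<^esub>" if w: "w \<in> U" "w \<noteq> \<epsilon> i" for w
    proof (rule smult_eq_smult_imp_zero)
      show "F (\<phi> w) i \<in> carrier (L i)" using F_ext i by blast
      have "T\<^sub>e (\<phi> w) = w *\<^sub>C \<phi> w" using eig w by simp
      then show "\<epsilon> i \<odot>\<^bsub>L i\<^esub> F (\<phi> w) i = w \<odot>\<^bsub>L i\<^esub> F (\<phi> w) i"
        using assms(11) dom i w F_scale by metis
    qed (use w in auto)
    show ?thesis
    proof (rule continuous_map_constant_off_point[OF _ _ U off z])
      show "continuous_map (top_of_set U) (norm_topology (L i)) (\<lambda>w. F (\<phi> w) i)"
        using continuous_map_compose[OF cont assms(12)[rule_format, OF i]] by (simp add: o_def)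
      show "t1_space (norm_topology (L i))"
        unfolding norm_topology_def by (rule t1_space_mtopology)
      show "\<zero>\<^bsub>L i\<^esub> \<in> topspace (norm_topology (L i))"
        by (simp add: norm_topology_def)
    qed
  qed
  have "F (\<phi> z) = F 0"
    using PiE_ext[OF F_ext F_ext] coord F_zero by metis
  then show "\<phi> z = 0"
    using assms(2,10) dom z by (auto dest: inj_onD intro: complex_vector.subspace_0)
qed

end
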